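(* Let $A,B\in\mathbb{P}_n$. Then $$A*B=\max_{X\in\operatorname{span}\{A,B\}}\left\{X=X^*:\begin{pmatrix}A & X \\ X & B\end{pmatrix}\succeq0\right\}=\max_{a,b\in\mathbb{R}}\left\{aA+bB:\begin{pmatrix}A & aA+bB \\ aA+bB & B\end{pmatrix}\succeq0\right\},$$ where the maxima are taken with respect to the Löwner order; that is, $A*B$ belongs to each of the two sets and is the greatest element of each set for the order $\preceq$.
   Context: $\mathbb{P}_n$ is the set of $n\times n$ complex Hermitian positive definite matrices; $X^*$ is the conjugate transpose of $X$. For Hermitian matrices, $M\succeq0$ means $M$ is positive semidefinite, and $X\preceq Y$ (Löwner order) means $Y-X\succeq0$. $\operatorname{span}\{A,B\}$ is the real linear span of $A$ and $B$. For $A,B\in\mathbb{P}_n$, $$A*B=\frac{1}{\sqrt{\lambda_{\min}}+\sqrt{\lambda_{\max}}}\left(B+\sqrt{\lambda_{\min}\lambda_{\max}}\,A\right),$$ where $\lambda_{\min},\lambda_{\max}$ are the smallest and largest eigenvalues of $BA^{-1}$. *)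

theory Defs
  imports "HOL-Analysis.Analysis"
begin

definition ctranspose :: "complex^'n^'m \<Rightarrow> complex^'m^'n" where
  "ctranspose X = map_matrix cnj (transpose X)"

definition hermitian :: "complex^'n^'n \<Rightarrow> bool" where
  "hermitian X \<longleftrightarrow> ctranspose X = X"

definition quad_form :: "complex^'n^'n \<Rightarrow> complex^'n \<Rightarrow> complex" where
  "quad_form M x = (\<Sum>i\<in>UNIV. cnj (x $ i) * (M *v x) $ i)"

text \<open>The quadratic form of a Hermitian matrix is real-valued, so taking the real part
  in the next two definitions loses nothing.\<close>

definition psd :: "complex^'n^'n \<Rightarrow> bool" where
  "psd M \<longleftrightarrow> hermitian M \<and> (\<forall>x. 0 \<le> Re (quad_form M x))"

definition posdef_matrices :: "(complex^'n^'n) set" where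
  "posdef_matrices = {M. hermitian M \<and> (\<forall>x. x \<noteq> 0 \<longrightarrow> 0 < Re (quad_form M x))}"

definition loewner_le :: "complex^'n^'n \<Rightarrow> complex^'n^'n \<Rightarrow> bool"  (infix "\<preceq>\<^sub>L" 50) where
  "X \<preceq>\<^sub>L Y \<longleftrightarrow> psd (Y - X)"

definition is_loewner_max :: "complex^'n^'n \<Rightarrow> (complex^'n^'n) set \<Rightarrow> bool" where
  "is_loewner_max M S \<longleftrightarrow> M \<in> S \<and> (\<forall>X\<in>S. X \<preceq>\<^sub>L M)"

text \<open>The \<open>2 \<times> 2\<close> block matrix with first block row \<open>P, Q\<close> and second block row \<open>R, S\<close>;
  \<open>Inl\<close> indexes the first block and \<open>Inr\<close> the second.\<close>

definition block_matrix ::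
  "complex^'n^'n \<Rightarrow> complex^'n^'n \<Rightarrow> complex^'n^'n \<Rightarrow> complex^'n^'n
    \<Rightarrow> complex^('n + 'n)^('n + 'n)" where
  "block_matrix P Q R S = (\<chi> i j.
     case i of
       Inl k \<Rightarrow> (case j of Inl l \<Rightarrow> P $ k $ l | Inr l \<Rightarrow> Q $ k $ l)
     | Inr k \<Rightarrow> (case j of Inl l \<Rightarrow> R $ k $ l | Inr l \<Rightarrow> S $ k $ l))"

definition eigenvalue :: "complex^'n^'n \<Rightarrow> complex \<Rightarrow> bool" where
  "eigenvalue M c \<longleftrightarrow> (\<exists>v. v \<noteq> 0 \<and> M *v v = c *s v)"

text \<open>The following two are meaningful only for matrices all of whose eigenvalues are real.
  They are applied to \<open>B A\<^sup>-\<^sup>1\<close> with \<open>A\<close>, \<open>B\<close> positive definite, which is similar to the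
  positive definite matrix \<open>A\<^sup>-\<^sup>1\<^sup>/\<^sup>2 B A\<^sup>-\<^sup>1\<^sup>/\<^sup>2\<close>.\<close>

definition lambda_min :: "complex^'n^'n \<Rightarrow> real" where
  "lambda_min M = (LEAST t. eigenvalue M (complex_of_real t))"

definition lambda_max :: "complex^'n^'n \<Rightarrow> real" where
  "lambda_max M = (GREATEST t. eigenvalue M (complex_of_real t))"

definition mat_star :: "complex^'n^'n \<Rightarrow> complex^'n^'n \<Rightarrow> complex^'n^'n"  (infixl "\<star>" 70) where
  "A \<star> B =
    (let l = lambda_min (B ** matrix_inv A); u = lambda_max (B ** matrix_inv A)
     in (1 / (sqrt l + sqrt u)) *\<^sub>R (B + sqrt (l * u) *\<^sub>R A))"

end

theory Submission
  imports Defs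
begin

text \<open>Regard \<open>\<complex>\<^sup>n\<close> as a real inner product space, so that a Hermitian matrix is a
  self-adjoint operator. With \<open>l\<close> and \<open>u\<close> the extreme values of the Rayleigh quotient of \<open>B\<close>
  relative to \<open>A\<close>, the matrices \<open>P = B - l A\<close> and \<open>Q = u A - B\<close> are positive semidefinite and,
  with \<open>C = A \<star> B\<close>, \<open>p = \<surd>l\<close> and \<open>r = \<surd>u\<close>,
  \[(u - l) (\langle x, A x\rangle + 2 \langle x, C y\rangle + \langle y, B y\rangle)
    = \langle x + r y, P (x + r y)\rangle + \langle x + p y, Q (x + p y)\rangle,\]
  so \<open>C\<close> is admissible. Conversely, testing the block matrix of \<open>a A + b B\<close> on the two extremal
  generalized eigenvectors gives \<open>a + b l \<le> \<surd>l\<close> and \<open>a + b u \<le> \<surd>u\<close>. Since \<open>C\<close> is the chord of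
  the square root through \<open>l\<close> and \<open>u\<close> evaluated at \<open>B\<close> relative to \<open>A\<close>, this yields
  \<open>a A + b B \<preceq> C\<close>.\<close>

section \<open>Hermitian matrices as self-adjoint real operators\<close>

lemma scaleR_matrix_vector_mult:
  fixes M :: "'a::real_algebra_1^'n^'m"
  shows "(c *\<^sub>R M) *v x = c *\<^sub>R (M *v x)"
  by (simp add: vec_eq_iff matrix_vector_mult_def scaleR_sum_right)

lemma matrix_vector_mult_scaleR_right:
  fixes M :: "'a::real_algebra_1^'n^'m"
  shows "M *v (c *\<^sub>R x) = c *\<^sub>R (M *v x)"
  by (simp add: linear_cmul)

lemmas matrix_vector_linear_simps =
  scaleR_matrix_vector_mult matrix_vector_mult_scaleR_right
  matrix_vector_right_distrib matrix_vector_mult_diff_distrib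
  matrix_vector_mult_add_rdistrib matrix_vector_mult_diff_rdistrib

text \<open>The library inner product on \<open>complex^'n\<close> is the real part of the Hermitian
  one, so all positivity conditions become statements in a real inner product space.\<close>

lemma Re_quad_form: "Re (quad_form M x) = x \<bullet> (M *v x)"
  by (simp add: quad_form_def inner_vec_def inner_complex_def)

lemma hermitian_iff: "hermitian M \<longleftrightarrow> (\<forall>i j. cnj (M $ j $ i) = M $ i $ j)"
  by (simp add: hermitian_def ctranspose_def vec_eq_iff transpose_def)

lemma hermitian_add: "hermitian M \<Longrightarrow> hermitian N \<Longrightarrow> hermitian (M + N)"
  by (simp add: hermitian_iff)

lemma hermitian_diff: "hermitian M \<Longrightarrow> hermitian N \<Longrightarrow> hermitian (M - N)"
  by (simp add: hermitian_iff)

lemma hermitian_scaleR: "hermitian M \<Longrightarrow> hermitian (c *\<^sub>R M)"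
  by (simp add: hermitian_iff)

lemma hermitian_uminus: "hermitian M \<Longrightarrow> hermitian (- M)"
  by (simp add: hermitian_iff)

lemma hermitian_inner:
  assumes "hermitian M"
  shows "(M *v x) \<bullet> y = x \<bullet> (M *v y)"
proof -
  have "(M *v x) \<bullet> y = (\<Sum>i\<in>UNIV. \<Sum>j\<in>UNIV. (M $ i $ j * x $ j) \<bullet> y $ i)"
    by (simp add: inner_vec_def matrix_vector_mult_def inner_sum_left)
  also have "\<dots> = (\<Sum>j\<in>UNIV. \<Sum>i\<in>UNIV. (M $ i $ j * x $ j) \<bullet> y $ i)"
    by (rule sum.swap)
  also have "\<dots> = (\<Sum>j\<in>UNIV. \<Sum>i\<in>UNIV. x $ j \<bullet> (cnj (M $ i $ j) * y $ i))"
    by (simp add: inner_complex_def algebra_simps)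
  also have "\<dots> = x \<bullet> (M *v y)"
    using assms by (simp add: hermitian_iff inner_vec_def matrix_vector_mult_def inner_sum_right)
  finally show ?thesis .
qed

lemma psd_iff: "psd M \<longleftrightarrow> hermitian M \<and> (\<forall>x. 0 \<le> x \<bullet> (M *v x))"
  by (simp add: psd_def Re_quad_form)

lemma posdef_iff:
  "M \<in> posdef_matrices \<longleftrightarrow> hermitian M \<and> (\<forall>x. x \<noteq> 0 \<longrightarrow> 0 < x \<bullet> (M *v x))"
  by (simp add: posdef_matrices_def Re_quad_form)

lemma posdef_inner_ge_0: "M \<in> posdef_matrices \<Longrightarrow> 0 \<le> x \<bullet> (M *v x)"
  by (cases "x = 0") (auto simp: posdef_iff less_imp_le)

text \<open>A nonnegative form that vanishes at \<open>w\<close> has a minimum there, so its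
  derivative at \<open>w\<close> in the direction \<open>M *v w\<close>, twice the squared norm of
  \<open>M *v w\<close>, must be zero.\<close>

lemma psd_null_vector:
  assumes "psd M" and w: "w \<bullet> (M *v w) = 0"
  shows "M *v w = 0"
proof -
  define y where "y = M *v w"
  define n where "n = y \<bullet> y"
  define c where "c = y \<bullet> (M *v y)"
  have h: "hermitian M" and pos: "\<And>x. 0 \<le> x \<bullet> (M *v x)"
    using assms by (auto simp: psd_iff)
  have "w \<bullet> (M *v y) = n"
    using hermitian_inner[OF h, of w y] by (simp add: n_def y_def)
  then have q: "(w + t *\<^sub>R y) \<bullet> (M *v (w + t *\<^sub>R y)) = 2 * t * n + t^2 * c" for t
    using w unfolding matrix_vector_linear_simps inner_add_left inner_add_right c_def n_def
    by (simp add: y_def[symmetric] power2_eq_square algebra_simps)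
  have "c \<ge> 0"
    using pos by (simp add: c_def)
  \<comment> \<open>Near the minimizer \<open>- n / c\<close> of \<open>2 * t * n + t^2 * c\<close>;
    the shifted denominator also covers \<open>c = 0\<close>.\<close>
  define t where "t = - n / (c + 1)"
  have "n = - t * (c + 1)"
    using \<open>c \<ge> 0\<close> by (simp add: t_def)
  then have "2 * t * n + t^2 * c = - (t^2 * (c + 2))"
    by algebra
  then have "t^2 * (c + 2) \<le> 0"
    using pos[of "w + t *\<^sub>R y"] q[of t] by linarith
  then have "t = 0"
    using \<open>c \<ge> 0\<close> by (simp add: mult_le_0_iff)
  then have "n = 0"
    using \<open>n = - t * (c + 1)\<close> by simp
  then show ?thesis
    by (simp add: n_def y_def)
qed

section \<open>Block matrices\<close>

lemma sum_UNIV_sum: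
  fixes f :: "'a::finite + 'b::finite \<Rightarrow> 'c::comm_monoid_add"
  shows "sum f UNIV = (\<Sum>i\<in>UNIV. f (Inl i)) + (\<Sum>i\<in>UNIV. f (Inr i))"
  by (subst UNIV_Plus_UNIV[symmetric], subst sum.Plus) auto

lemma inner_block_matrix:
  fixes z :: "complex^('n::finite + 'n)"
  defines "x \<equiv> \<chi> k. z $ Inl k" and "y \<equiv> \<chi> k. z $ Inr k"
  shows "z \<bullet> (block_matrix P Q R S *v z) =
    x \<bullet> (P *v x) + x \<bullet> (Q *v y) + y \<bullet> (R *v x) + y \<bullet> (S *v y)"
  by (simp add: x_def y_def inner_vec_def block_matrix_def matrix_vector_mult_def sum_UNIV_sum
      inner_add_right sum.distrib)

lemma hermitian_block_matrix:
  "hermitian (block_matrix P X X S) \<longleftrightarrow> hermitian P \<and> hermitian X \<and> hermitian S"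
  unfolding hermitian_iff block_matrix_def by (force simp: split_sum_all)

text \<open>Self-adjointness of \<open>X\<close> makes the two off-diagonal contributions equal,
  which gives the factor 2.\<close>

lemma psd_block_matrix_iff:
  "psd (block_matrix P X X S) \<longleftrightarrow> hermitian P \<and> hermitian X \<and> hermitian S \<and>
    (\<forall>x y. 0 \<le> x \<bullet> (P *v x) + 2 * (x \<bullet> (X *v y)) + y \<bullet> (S *v y))"
proof (cases "hermitian P \<and> hermitian X \<and> hermitian S")
  case True
  then have sym: "y \<bullet> (X *v x) = x \<bullet> (X *v y)" for x y
    by (metis hermitian_inner inner_commute)
  have "(\<forall>z. 0 \<le> z \<bullet> (block_matrix P X X S *v z)) \<longleftrightarrow>
    (\<forall>x y. 0 \<le> x \<bullet> (P *v x) + 2 * (x \<bullet> (X *v y)) + y \<bullet> (S *v y))" (is "?L \<longleftrightarrow> ?R")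
  proof
    assume ?L
    show ?R
    proof (intro allI)
      fix x y
      show "0 \<le> x \<bullet> (P *v x) + 2 * (x \<bullet> (X *v y)) + y \<bullet> (S *v y)"
        using \<open>?L\<close>[rule_format, of "\<chi> i. case i of Inl k \<Rightarrow> x $ k | Inr k \<Rightarrow> y $ k"]
        by (simp add: inner_block_matrix sym[of y x])
    qed
  next
    assume ?R
    then show ?L
      by (auto simp: inner_block_matrix sym[of "\<chi> k. _ $ Inr k"] add.assoc)
  qed
  with True show ?thesis
    by (simp add: psd_iff hermitian_block_matrix)
qed (auto simp: psd_iff hermitian_block_matrix)

section \<open>Extremal generalized eigenvalues\<close>

text \<open>By compactness the Rayleigh quotient of \<open>B\<close> relative to \<open>A\<close>
  attains its minimum \<open>l\<close> on the unit sphere. Minimality makes \<open>B - l A\<close>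
  positive semidefinite with a form vanishing at \<open>w\<close>, and
  \<open>psd_null_vector\<close> turns this into the eigenvector equation.\<close>

lemma generalized_rayleigh_min:
  assumes A: "A \<in> posdef_matrices" and B: "hermitian B"
  obtains l w where "w \<noteq> 0" "B *v w = l *\<^sub>R (A *v w)" "psd (B - l *\<^sub>R A)"
proof -
  define f where "f = (\<lambda>x. (x \<bullet> (B *v x)) / (x \<bullet> (A *v x)))"
  have pos: "0 < x \<bullet> (A *v x)" if "x \<noteq> 0" for x
    using A that by (simp add: posdef_iff)
  have "x \<bullet> (A *v x) \<noteq> 0" if "x \<in> sphere 0 1" for x
    using pos[of x] that by (cases "x = 0") auto
  then have "continuous_on (sphere 0 1) f"
    unfolding f_def
    by (intro continuous_intros linear_continuous_on matrix_vector_mul_bounded_linear) blast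
  moreover have "sphere 0 1 \<noteq> ({} :: (complex^'n) set)"
    by simp
  ultimately obtain w where w: "w \<in> sphere 0 1" and min: "\<And>x. x \<in> sphere 0 1 \<Longrightarrow> f w \<le> f x"
    using continuous_attains_inf[OF compact_sphere] by blast
  have "w \<noteq> 0"
    using w by auto
  have min': "f w * (x \<bullet> (A *v x)) \<le> x \<bullet> (B *v x)" for x
  proof (cases "x = 0")
    case False
    \<comment> \<open>The quotient is invariant under scaling, so the bound extends from the sphere
      to all nonzero vectors.\<close>
    have "f (x /\<^sub>R norm x) = f x"
      using False by (simp add: f_def matrix_vector_mult_scaleR_right)
    then have "f w \<le> f x"
      using min[of "x /\<^sub>R norm x"] False by simp
    then show ?thesis
      using pos[OF False] by (simp add: f_def pos_le_divide_eq)
  qed simp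
  have psd: "psd (B - f w *\<^sub>R A)"
    using A B min'
    by (auto simp: psd_iff posdef_iff matrix_vector_linear_simps inner_diff_right
        intro!: hermitian_diff hermitian_scaleR)
  have "w \<bullet> ((B - f w *\<^sub>R A) *v w) = 0"
    using pos[OF \<open>w \<noteq> 0\<close>] by (simp add: f_def matrix_vector_linear_simps inner_diff_right)
  from psd_null_vector[OF psd this] have "B *v w = f w *\<^sub>R (A *v w)"
    by (simp add: matrix_vector_linear_simps)
  with \<open>w \<noteq> 0\<close> psd show ?thesis
    using that by blast
qed

lemma generalized_rayleigh_max:
  assumes "A \<in> posdef_matrices" and "hermitian B"
  obtains u w where "w \<noteq> 0" "B *v w = u *\<^sub>R (A *v w)" "psd (u *\<^sub>R A - B)"
proof -
  obtain l w where w: "w \<noteq> 0" "(- B) *v w = l *\<^sub>R (A *v w)" "psd (- B - l *\<^sub>R A)"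
    using generalized_rayleigh_min[OF assms(1) hermitian_uminus[OF assms(2)]] by metis
  have "(- B) *v w = - (B *v w)"
    using scaleR_matrix_vector_mult[of "-1" B w] by simp
  then have "B *v w = (- l) *\<^sub>R (A *v w)"
    using w(2) by (metis minus_minus scaleR_minus_left)
  moreover have "psd ((- l) *\<^sub>R A - B)"
    using w(3) by (simp add: minus_diff_commute)
  ultimately show ?thesis
    using w(1) that by blast
qed

lemma invertible_matrix_inv:
  assumes "invertible A"
  shows "A ** matrix_inv A = mat 1 \<and> matrix_inv A ** A = mat 1"
  using assms unfolding invertible_def matrix_inv_def by (rule someI_ex)

text \<open>The substitution \<open>v = A *v w\<close> matches eigenvectors \<open>v\<close> of
  \<open>B ** matrix_inv A\<close> with generalized eigenvectors \<open>w\<close>.\<close>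

lemma eigenvalue_mult_matrix_inv:
  assumes A: "A \<in> posdef_matrices"
  shows "eigenvalue (B ** matrix_inv A) (complex_of_real t) \<longleftrightarrow>
    (\<exists>w. w \<noteq> 0 \<and> B *v w = t *\<^sub>R (A *v w))"
proof -
  have of_real: "complex_of_real t *s v = t *\<^sub>R v" for v :: "complex^'n"
    by (simp add: vec_eq_iff scaleR_conv_of_real[where 'a = complex])
  have ker: "A *v x = 0 \<Longrightarrow> x = 0" for x
    using A by (force simp: posdef_iff)
  then have "invertible A"
    by (simp add: invertible_left_inverse matrix_left_invertible_ker)
  then have inv: "A *v (matrix_inv A *v v) = v" "matrix_inv A *v (A *v v) = v" for v
    by (simp_all add: matrix_vector_mul_assoc invertible_matrix_inv)
  show ?thesis
  proof
    assume "eigenvalue (B ** matrix_inv A) (complex_of_real t)"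
    then obtain v where "v \<noteq> 0" "B *v (matrix_inv A *v v) = t *\<^sub>R v"
      by (auto simp: eigenvalue_def of_real matrix_vector_mul_assoc)
    then show "\<exists>w. w \<noteq> 0 \<and> B *v w = t *\<^sub>R (A *v w)"
      using inv(1)[of v] by (intro exI[of _ "matrix_inv A *v v"]) auto
  next
    assume "\<exists>w. w \<noteq> 0 \<and> B *v w = t *\<^sub>R (A *v w)"
    then obtain w where "w \<noteq> 0" "B *v w = t *\<^sub>R (A *v w)"
      by blast
    then show "eigenvalue (B ** matrix_inv A) (complex_of_real t)"
      unfolding eigenvalue_def using ker[of w]
      by (intro exI[of _ "A *v w"]) (auto simp: of_real matrix_vector_mul_assoc[symmetric] inv)
  qed
qed

lemma lambda_min_eqI:
  assumes A: "A \<in> posdef_matrices" and w: "w \<noteq> 0" "B *v w = l *\<^sub>R (A *v w)"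
    and psd: "psd (B - l *\<^sub>R A)"
  shows "lambda_min (B ** matrix_inv A) = l"
  unfolding lambda_min_def
proof (rule Least_equality)
  show "eigenvalue (B ** matrix_inv A) (complex_of_real l)"
    using w by (auto simp: eigenvalue_mult_matrix_inv[OF A])
next
  fix t
  assume "eigenvalue (B ** matrix_inv A) (complex_of_real t)"
  then obtain x where x: "x \<noteq> 0" "B *v x = t *\<^sub>R (A *v x)"
    by (auto simp: eigenvalue_mult_matrix_inv[OF A])
  have "0 \<le> x \<bullet> ((B - l *\<^sub>R A) *v x)"
    using psd by (simp add: psd_iff)
  then have "l * (x \<bullet> (A *v x)) \<le> t * (x \<bullet> (A *v x))"
    by (simp add: matrix_vector_linear_simps x inner_diff_right)
  then show "l \<le> t"
    using A x(1) by (simp add: posdef_iff)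
qed

lemma lambda_max_eqI:
  assumes A: "A \<in> posdef_matrices" and w: "w \<noteq> 0" "B *v w = u *\<^sub>R (A *v w)"
    and psd: "psd (u *\<^sub>R A - B)"
  shows "lambda_max (B ** matrix_inv A) = u"
  unfolding lambda_max_def
proof (rule Greatest_equality)
  show "eigenvalue (B ** matrix_inv A) (complex_of_real u)"
    using w by (auto simp: eigenvalue_mult_matrix_inv[OF A])
next
  fix t
  assume "eigenvalue (B ** matrix_inv A) (complex_of_real t)"
  then obtain x where x: "x \<noteq> 0" "B *v x = t *\<^sub>R (A *v x)"
    by (auto simp: eigenvalue_mult_matrix_inv[OF A])
  have "0 \<le> x \<bullet> ((u *\<^sub>R A - B) *v x)"
    using psd by (simp add: psd_iff)
  then have "t * (x \<bullet> (A *v x)) \<le> u * (x \<bullet> (A *v x))"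
    by (simp add: matrix_vector_linear_simps x inner_diff_right)
  then show "t \<le> u"
    using A x(1) by (simp add: posdef_iff)
qed

lemma generalized_eigenvalue_pos:
  assumes "A \<in> posdef_matrices" "B \<in> posdef_matrices" "w \<noteq> 0" "B *v w = t *\<^sub>R (A *v w)"
  shows "0 < t"
proof -
  have "0 < w \<bullet> (B *v w)" "0 < w \<bullet> (A *v w)"
    using assms by (auto simp: posdef_iff)
  then show ?thesis
    using assms(4) by (simp add: zero_less_mult_iff)
qed

section \<open>The extremal characterization\<close>

text \<open>On pairs of multiples of \<open>w\<close> the block form is a positive multiple of the
  form of the 2 by 2 matrix with diagonal \<open>1\<close>, \<open>t\<close> and off-diagonal entry
  \<open>a + b * t\<close>, which positivity bounds by \<open>sqrt t\<close>.\<close>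

lemma psd_block_coeff_le:
  assumes A: "A \<in> posdef_matrices" and B: "B \<in> posdef_matrices"
    and w: "w \<noteq> 0" "B *v w = t *\<^sub>R (A *v w)"
    and psd: "psd (block_matrix A (a *\<^sub>R A + b *\<^sub>R B) (a *\<^sub>R A + b *\<^sub>R B) B)"
  shows "a + b * t \<le> sqrt t"
proof -
  define s where "s = sqrt t"
  have "0 < t"
    using generalized_eigenvalue_pos[OF A B w] .
  then have "0 < s" "t = s^2"
    by (simp_all add: s_def)
  define c where "c = w \<bullet> (A *v w)"
  have "0 < c"
    using A w by (simp add: posdef_iff c_def)
  \<comment> \<open>The pair \<open>(s w, - w)\<close> balances the diagonal terms at
    \<open>s^2 * c\<close> each and gives the cross term the sign needed for an upper bound.\<close>
  have "0 \<le> (s *\<^sub>R w) \<bullet> (A *v (s *\<^sub>R w))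
      + 2 * ((s *\<^sub>R w) \<bullet> ((a *\<^sub>R A + b *\<^sub>R B) *v (- 1 *\<^sub>R w)))
      + (- 1 *\<^sub>R w) \<bullet> (B *v (- 1 *\<^sub>R w))"
    using psd unfolding psd_block_matrix_iff by blast
  also have "\<dots> = 2 * s * c * (s - (a + b * t))"
    unfolding matrix_vector_linear_simps w
    by (simp add: c_def[symmetric] inner_add_right \<open>t = s^2\<close> power2_eq_square algebra_simps)
  finally show ?thesis
    using mult_pos_pos[OF \<open>0 < c\<close> \<open>0 < s\<close>] by (simp add: zero_le_mult_iff s_def[symmetric])
qed

text \<open>At each \<open>x\<close> the form of \<open>B\<close> lies between \<open>l\<close> and
  \<open>u\<close> times that of \<open>A\<close>, and an affine function nonnegative at both ends
  of an interval is nonnegative on it. The sign of \<open>\<beta>\<close> decides which end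
  matters.\<close>

lemma psd_affine_combination:
  assumes A: "A \<in> posdef_matrices" and "hermitian B"
    and l: "psd (B - l *\<^sub>R A)" "0 \<le> \<alpha> + \<beta> * l"
    and u: "psd (u *\<^sub>R A - B)" "0 \<le> \<alpha> + \<beta> * u"
  shows "psd (\<alpha> *\<^sub>R A + \<beta> *\<^sub>R B)"
proof -
  have "0 \<le> \<alpha> * (x \<bullet> (A *v x)) + \<beta> * (x \<bullet> (B *v x))" for x
  proof -
    define p where "p = x \<bullet> (A *v x)"
    define q where "q = x \<bullet> (B *v x)"
    have "0 \<le> p"
      using posdef_inner_ge_0[OF A] by (simp add: p_def)
    have lq: "l * p \<le> q" and qu: "q \<le> u * p"
      using l(1) u(1)
      by (simp_all add: psd_iff matrix_vector_linear_simps inner_diff_right p_def q_def)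
    show ?thesis
    proof (cases "0 \<le> \<beta>")
      case True
      then have "\<beta> * (l * p) \<le> \<beta> * q"
        using lq by (rule mult_left_mono[rotated])
      moreover have "0 \<le> (\<alpha> + \<beta> * l) * p"
        using l(2) \<open>0 \<le> p\<close> by simp
      ultimately show ?thesis
        by (simp add: p_def[symmetric] q_def[symmetric] algebra_simps)
    next
      case False
      then have "\<beta> * (u * p) \<le> \<beta> * q"
        using qu by (intro mult_left_mono_neg) auto
      moreover have "0 \<le> (\<alpha> + \<beta> * u) * p"
        using u(2) \<open>0 \<le> p\<close> by simp
      ultimately show ?thesis
        by (simp add: p_def[symmetric] q_def[symmetric] algebra_simps)
    qed
  qed
  then show ?thesis
    using A \<open>hermitian B\<close>
    by (auto simp: psd_iff posdef_iff matrix_vector_linear_simps inner_add_right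
        intro!: hermitian_add hermitian_scaleR)
qed

lemma psd_block_chord:
  assumes A: "A \<in> posdef_matrices" and hB: "hermitian B"
    and l: "psd (B - p^2 *\<^sub>R A)" and u: "psd (r^2 *\<^sub>R A - B)"
    and pr: "0 < p" "p \<le> r"
  defines "C \<equiv> (1 / (p + r)) *\<^sub>R (B + (p * r) *\<^sub>R A)"
  shows "psd (block_matrix A C C B)"
proof -
  have hA: "hermitian A"
    using A by (simp add: posdef_iff)
  have hC: "hermitian C"
    unfolding C_def by (intro hermitian_add hermitian_scaleR hA hB)
  have "0 \<le> x \<bullet> (A *v x) + 2 * (x \<bullet> (C *v y)) + y \<bullet> (B *v y)" for x y
  proof -
    define axx where "axx = x \<bullet> (A *v x)"
    define axy where "axy = x \<bullet> (A *v y)"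
    define ayy where "ayy = y \<bullet> (A *v y)"
    define bxx where "bxx = x \<bullet> (B *v x)"
    define bxy where "bxy = x \<bullet> (B *v y)"
    define byy where "byy = y \<bullet> (B *v y)"
    have sym: "y \<bullet> (A *v x) = axy" "y \<bullet> (B *v x) = bxy"
      using hermitian_inner[OF hA, of x y] hermitian_inner[OF hB, of x y]
      by (simp_all add: axy_def bxy_def inner_commute)
    note abs = sym axx_def[symmetric] axy_def[symmetric] ayy_def[symmetric]
      bxx_def[symmetric] bxy_def[symmetric] byy_def[symmetric]
    \<comment> \<open>\<open>P\<close> and \<open>Q\<close> evaluate the two positive semidefinite
      forms at \<open>x + s y\<close>. General \<open>s\<close> is kept because the cases below use
      different values.\<close>
    have P: "0 \<le> bxx + 2 * s * bxy + s^2 * byy - p^2 * (axx + 2 * s * axy + s^2 * ayy)" for s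
    proof -
      have "0 \<le> (x + s *\<^sub>R y) \<bullet> ((B - p^2 *\<^sub>R A) *v (x + s *\<^sub>R y))"
        using l by (simp add: psd_iff)
      then show ?thesis
        unfolding matrix_vector_linear_simps inner_add_left inner_add_right inner_diff_right
        by (simp add: abs inner_add_right algebra_simps power2_eq_square)
    qed
    have Q: "0 \<le> r^2 * (axx + 2 * s * axy + s^2 * ayy) - (bxx + 2 * s * bxy + s^2 * byy)" for s
    proof -
      have "0 \<le> (x + s *\<^sub>R y) \<bullet> ((r^2 *\<^sub>R A - B) *v (x + s *\<^sub>R y))"
        using u by (simp add: psd_iff)
      then show ?thesis
        unfolding matrix_vector_linear_simps inner_add_left inner_add_right inner_diff_right
        by (simp add: abs inner_add_right algebra_simps power2_eq_square)
    qed
    define F where "F = axx + 2 * ((bxy + p * r * axy) / (p + r)) + byy"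
    have goal: "x \<bullet> (A *v x) + 2 * (x \<bullet> (C *v y)) + y \<bullet> (B *v y) = F"
      by (simp add: C_def F_def matrix_vector_linear_simps inner_add_right abs)
    have F_mult: "(p + r) * F = (p + r) * (axx + byy) + 2 * (bxy + p * r * axy)"
      using pr by (simp add: F_def field_simps)
    have "0 \<le> F"
    proof (cases "p = r")
      \<comment> \<open>The identity behind the other case carries the factor \<open>r - p\<close>,
        so equal extreme values need a direct argument.\<close>
      case True
      have "byy \<ge> p^2 * ayy"
      proof -
        have "0 \<le> y \<bullet> ((B - p^2 *\<^sub>R A) *v y)"
          using l by (simp add: psd_iff)
        then show ?thesis
          by (simp add: matrix_vector_linear_simps inner_diff_right abs)
      qed
      \<comment> \<open>Here \<open>B - p\<^sup>2 A\<close> and its negative are both positive semidefinite, so \<open>B = p\<^sup>2 A\<close>.\<close>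
      have "bxx + 2 * s * bxy + s^2 * byy = p^2 * (axx + 2 * s * axy + s^2 * ayy)" for s
        using P[of s] Q[of s] True by simp
      \<comment> \<open>Polarization: comparing \<open>s = 1\<close> with \<open>s = -1\<close>
        isolates the mixed terms.\<close>
      from this[of 0] this[of 1] this[of "-1"] have "bxy = p^2 * axy"
        by (simp add: algebra_simps)
      have "0 \<le> (x + p *\<^sub>R y) \<bullet> (A *v (x + p *\<^sub>R y))"
        by (rule posdef_inner_ge_0[OF A])
      then have "0 \<le> axx + 2 * p * axy + p^2 * ayy"
        unfolding matrix_vector_linear_simps inner_add_left inner_add_right
        by (simp add: abs algebra_simps power2_eq_square)
      moreover have "F = axx + 2 * p * axy + byy"
        using True pr \<open>bxy = p^2 * axy\<close> by (simp add: F_def field_simps power2_eq_square)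
      ultimately show ?thesis
        using \<open>byy \<ge> p^2 * ayy\<close> by linarith
    next
      case False
      \<comment> \<open>Pairing the lower bound \<open>p\<close> with \<open>s = r\<close> and the
        upper bound \<open>r\<close> with \<open>s = p\<close> cancels the \<open>bxx\<close> and
        \<open>ayy\<close> terms.\<close>
      have "(r - p) * ((p + r) * F) =
        (bxx + 2 * r * bxy + r^2 * byy - p^2 * (axx + 2 * r * axy + r^2 * ayy)) +
        (r^2 * (axx + 2 * p * axy + p^2 * ayy) - (bxx + 2 * p * bxy + p^2 * byy))"
        unfolding F_mult by (simp add: power2_eq_square algebra_simps)
      then have "0 \<le> (r - p) * ((p + r) * F)"
        using P[of r] Q[of p] by linarith
      then show ?thesis
        using False pr by (simp add: zero_le_mult_iff)
    qed
    then show ?thesis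
      by (simp add: goal)
  qed
  then show ?thesis
    using hA hB hC by (simp add: psd_block_matrix_iff)
qed

theorem theorem2p8:
  fixes A B :: "complex^'n^'n"
  assumes "A \<in> posdef_matrices" and "B \<in> posdef_matrices"
  shows "is_loewner_max (A \<star> B)
           {X \<in> span {A, B}. X = ctranspose X \<and> psd (block_matrix A X X B)}
       \<and> is_loewner_max (A \<star> B)
           {a *\<^sub>R A + b *\<^sub>R B | a b :: real.
             psd (block_matrix A (a *\<^sub>R A + b *\<^sub>R B) (a *\<^sub>R A + b *\<^sub>R B) B)}"
proof -
  let ?S1 = "{X \<in> span {A, B}. X = ctranspose X \<and> psd (block_matrix A X X B)}"
  let ?S2 = "{a *\<^sub>R A + b *\<^sub>R B | a b :: real.
    psd (block_matrix A (a *\<^sub>R A + b *\<^sub>R B) (a *\<^sub>R A + b *\<^sub>R B) B)}"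
  have hB: "hermitian B"
    using assms by (simp add: posdef_iff)
  obtain l v where v: "v \<noteq> 0" "B *v v = l *\<^sub>R (A *v v)" and l: "psd (B - l *\<^sub>R A)"
    using generalized_rayleigh_min[OF assms(1) hB] by metis
  obtain u w where w: "w \<noteq> 0" "B *v w = u *\<^sub>R (A *v w)" and u: "psd (u *\<^sub>R A - B)"
    using generalized_rayleigh_max[OF assms(1) hB] by metis
  define p where "p = sqrt l"
  define r where "r = sqrt u"
  have "0 < l" "0 < u"
    using generalized_eigenvalue_pos assms v w by blast+
  then have pr: "0 < p" "0 < r" "l = p^2" "u = r^2"
    by (simp_all add: p_def r_def)
  have "l \<le> u"
  proof -
    have "0 \<le> v \<bullet> ((u *\<^sub>R A - B) *v v)"
      using u by (simp add: psd_iff)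
    then have "l * (v \<bullet> (A *v v)) \<le> u * (v \<bullet> (A *v v))"
      by (simp add: matrix_vector_linear_simps v inner_diff_right)
    then show ?thesis
      using assms(1) v(1) by (simp add: posdef_iff)
  qed
  then have "p \<le> r"
    by (simp add: p_def r_def)
  have star: "A \<star> B = (1 / (p + r)) *\<^sub>R (B + (p * r) *\<^sub>R A)"
    unfolding mat_star_def Let_def lambda_min_eqI[OF assms(1) v l] lambda_max_eqI[OF assms(1) w u]
    by (simp add: p_def r_def real_sqrt_mult)
  then have star': "A \<star> B = (p * r / (p + r)) *\<^sub>R A + (1 / (p + r)) *\<^sub>R B"
    by (simp add: algebra_simps)
  have "psd (block_matrix A (A \<star> B) (A \<star> B) B)"
    unfolding star using psd_block_chord[OF assms(1) hB] l u pr \<open>p \<le> r\<close> by simp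
  then have mem: "A \<star> B \<in> ?S2"
    using star' by (metis (mono_tags, lifting) mem_Collect_eq)
  have le: "X \<preceq>\<^sub>L A \<star> B" if X_in: "X \<in> ?S2" for X
  proof -
    obtain a b where X: "X = a *\<^sub>R A + b *\<^sub>R B"
      and psd: "psd (block_matrix A (a *\<^sub>R A + b *\<^sub>R B) (a *\<^sub>R A + b *\<^sub>R B) B)"
      using X_in by blast
    have "a + b * l \<le> p" "a + b * u \<le> r"
      using psd_block_coeff_le[OF assms v psd] psd_block_coeff_le[OF assms w psd]
      by (simp_all add: p_def r_def)
    \<comment> \<open>The chord \<open>(p * r + t) / (p + r)\<close> meets the square root at
      \<open>t = p^2\<close> and \<open>t = r^2\<close>.\<close>
    moreover have "p * r / (p + r) + 1 / (p + r) * l = p" "p * r / (p + r) + 1 / (p + r) * u = r"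
      using pr(1,2) unfolding pr(3,4)
    by (simp_all add: add_divide_distrib[symmetric] divide_eq_eq power2_eq_square algebra_simps)
    ultimately have "0 \<le> (p * r / (p + r) - a) + (1 / (p + r) - b) * l"
      "0 \<le> (p * r / (p + r) - a) + (1 / (p + r) - b) * u"
      unfolding left_diff_distrib by linarith+
    \<comment> \<open>These are the coefficients of the difference between the claimed maximum and
      \<open>X\<close>; the affine function they define is nonnegative at \<open>l\<close> and
      \<open>u\<close>.\<close>
    then have "psd ((p * r / (p + r) - a) *\<^sub>R A + (1 / (p + r) - b) *\<^sub>R B)"
      using psd_affine_combination[OF assms(1) hB l _ u] by blast
    then show ?thesis
      unfolding loewner_le_def star' X by (simp add: algebra_simps)
  qed
  have in_span: "a *\<^sub>R A + b *\<^sub>R B \<in> span {A, B}" for a b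
    by (intro span_add span_scale span_base) auto
  have "?S1 = ?S2"
  proof (intro set_eqI iffI)
    fix X
    assume "X \<in> ?S1"
    then show "X \<in> ?S2"
      by (auto simp: span_insert span_singleton algebra_simps)
  next
    fix X
    assume "X \<in> ?S2"
    then show "X \<in> ?S1"
      \<comment> \<open>Self-adjointness of \<open>X\<close> is read off from positivity of the
        block matrix.\<close>
      by (auto simp: psd_block_matrix_iff hermitian_def in_span)
  qed
  then show ?thesis
    using mem le by (simp add: is_loewner_max_def)
qed

end
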